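(* For every integer $n\ge 2$ let $(G^1_n,\boldsymbol c^1_n)$ be the EWMCP instance defined in the context. Then $$\frac{\mathrm{UB}_3(G^1_n,\boldsymbol c^1_n,n)}{\omega(G^1_n,\boldsymbol c^1_n)}\to+\infty\quad\text{as } n\to+\infty ,$$ where $n$ coincides with the clique number (maximum cardinality of a clique) of $G^1_n$.
   Context: An instance of the Edge-Weighted Maximum Clique Problem (EWMCP) is a pair $(G,\boldsymbol c)$ where $G=(V,E)$ is a finite simple undirected graph and $\boldsymbol c=(c_e)_{e\in E}$ is a vector of nonnegative integer edge-weights. A clique is a set of pairwise adjacent vertices. For a clique $C$, $E[C]$ is the set of edges with both endpoints in $C$; its total edge-weight is $\sum_{e\in E[C]}c_e$. The number $\omega(G,\boldsymbol c)$ is the maximum total edge-weight of a clique of $G$. For $u\in V$, $\delta(u)\subseteq E$ is the set of edges incident to $u$. Third upper bound. Let $k$ be an integer with $1\le k\le|V|$ that is an upper bound on the cardinality of every clique of $G$. For $u\in V$ and an integer $t\ge0$, $\delta_t(u)\subseteq\delta(u)$ denotes any set of the $\min\{t,|\delta(u)|\}$ heaviest edges incident to $u$. Set $\eta_u:=\frac12\sum_{e\in\delta_{k-1}(u)}c_e$ for $u\in V$, and order the vertices as $\varphi(1),\dots,\varphi(|V|)$ with $\eta_{\varphi(1)}\ge\eta_{\varphi(2)}\ge\dots\ge\eta_{\varphi(|V|)}$ (ties broken arbitrarily). Then $$\mathrm{UB}_3(G,\boldsymbol c,k):=\sum_{j=1}^{k}\eta_{\varphi(j)}.$$ The instances. For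 every integer $n\ge2$, $G^1_n=(V^1_n,E^1_n)$ has vertex set $\{1,\dots,2n\}$, partitioned into $C_1=\{1,\dots,n\}$ and $C_2=\{n+1,\dots,2n\}$. Its edges are: all edges between distinct vertices of $C_1$ and all edges between distinct vertices of $C_2$, each of weight $1$; and, for each $u\in C_1$, the edge $\{u,n+u\}$, of weight $\bar c=\frac{n(n-1)}{2}-1$. There are no other edges. These weights define $\boldsymbol c^1_n$. *)

theory Defs
  imports Complex_Main "HOL-Library.Ramsey"
begin

section \<open>Edge-weighted maximum clique instances\<close>

text \<open>
  An undirected edge is a two-element vertex set, and \<open>clique\<close> is the predicate of
  \<^theory>\<open>HOL-Library.Ramsey\<close>.  Weights are nonnegative integers by typing; only the values
  of \<open>c\<close> on \<open>E\<close> are ever used.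
\<close>

definition ewmcp_instance :: "'a set \<Rightarrow> 'a set set \<Rightarrow> ('a set \<Rightarrow> nat) \<Rightarrow> bool" where
  "ewmcp_instance V E c \<longleftrightarrow> finite V \<and> E \<subseteq> [V]\<^bsup>2\<^esup>"

definition cliques :: "'a set \<Rightarrow> 'a set set \<Rightarrow> 'a set set" where
  "cliques V E = {C. C \<subseteq> V \<and> clique C E}"

definition clique_number :: "'a set \<Rightarrow> 'a set set \<Rightarrow> nat" where
  "clique_number V E = Max (card ` cliques V E)"

definition induced_edges :: "'a set set \<Rightarrow> 'a set \<Rightarrow> 'a set set" where
  "induced_edges E C = {e \<in> E. e \<subseteq> C}"

definition clique_weight :: "'a set set \<Rightarrow> ('a set \<Rightarrow> nat) \<Rightarrow> 'a set \<Rightarrow> nat" where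
  "clique_weight E c C = (\<Sum>e\<in>induced_edges E C. c e)"

definition omega :: "'a set \<Rightarrow> 'a set set \<Rightarrow> ('a set \<Rightarrow> nat) \<Rightarrow> nat" where
  "omega V E c = Max (clique_weight E c ` cliques V E)"

definition incident_edges :: "'a set set \<Rightarrow> 'a \<Rightarrow> 'a set set" where
  "incident_edges E u = {e \<in> E. u \<in> e}"


section \<open>The upper bound\<close>

definition heaviest :: "('b \<Rightarrow> 'c::linorder) \<Rightarrow> nat \<Rightarrow> 'b set \<Rightarrow> 'b set \<Rightarrow> bool" where
  "heaviest w t A D \<longleftrightarrow>
     D \<subseteq> A \<and> card D = min t (card A) \<and> (\<forall>x\<in>D. \<forall>y\<in>A - D. w y \<le> w x)"

definition eta :: "('a set \<Rightarrow> nat) \<Rightarrow> ('a \<Rightarrow> 'a set set) \<Rightarrow> 'a \<Rightarrow> real" where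
  "eta c D u = 1 / 2 * (\<Sum>e\<in>D u. real (c e))"

definition nonincreasing_order :: "'a set \<Rightarrow> ('a \<Rightarrow> real) \<Rightarrow> (nat \<Rightarrow> 'a) \<Rightarrow> bool" where
  "nonincreasing_order V h \<phi> \<longleftrightarrow>
     bij_betw \<phi> {1..card V} V \<and>
     (\<forall>i\<in>{1..card V}. \<forall>j\<in>{1..card V}. i \<le> j \<longrightarrow> h (\<phi> j) \<le> h (\<phi> i))"

text \<open>
  \<open>is_UB3 V E c k x\<close>: some admissible choice of the heaviest incident edges \<open>D u\<close> and of the
  vertex order \<open>\<phi>\<close> yields the value \<open>x\<close>.  By \<open>is_UB3_ex1\<close> below, admissible choices exist and
  all of them yield the same value, so that \<open>UB3\<close> does not depend on how ties are broken.
\<close>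

definition is_UB3 ::
    "'a set \<Rightarrow> 'a set set \<Rightarrow> ('a set \<Rightarrow> nat) \<Rightarrow> nat \<Rightarrow> real \<Rightarrow> bool" where
  "is_UB3 V E c k x \<longleftrightarrow>
     (\<exists>D \<phi>. (\<forall>u\<in>V. heaviest c (k - 1) (incident_edges E u) (D u)) \<and>
            nonincreasing_order V (eta c D) \<phi> \<and>
            x = (\<Sum>j=1..k. eta c D (\<phi> j)))"

definition UB3 :: "'a set \<Rightarrow> 'a set set \<Rightarrow> ('a set \<Rightarrow> nat) \<Rightarrow> nat \<Rightarrow> real" where
  "UB3 V E c k = (THE x. is_UB3 V E c k x)"

lemma heaviest_sum_unique:
  fixes f :: "'b \<Rightarrow> real"
  assumes fin: "finite A" and D: "heaviest w t A D" and D': "heaviest w t A D'"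
    and f: "\<And>x y. x \<in> A \<Longrightarrow> y \<in> A \<Longrightarrow> w x = w y \<Longrightarrow> f x = f y"
  shows "sum f D = sum f D'"
proof -
  have sub: "D \<subseteq> A" "D' \<subseteq> A" and card: "card D = card D'"
    using D D' by (auto simp: heaviest_def)
  have finD: "finite D" "finite D'"
    using sub fin by (auto intro: finite_subset)
  have "card (D - D') + card (D \<inter> D') = card D" "card (D' - D) + card (D \<inter> D') = card D'"
    using finD by (metis card_Diff_subset_Int card_mono finite_Int Int_lower1 le_add_diff_inverse2,
      metis card_Diff_subset_Int card_mono finite_Int Int_lower1 Int_commute le_add_diff_inverse2)
  with card have cd: "card (D - D') = card (D' - D)" by simp
  have weq: "f x = f y" if "x \<in> D - D'" "y \<in> D' - D" for x y
  proof (rule f)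
    show "w x = w y"
      using D D' that sub unfolding heaviest_def by (meson DiffD1 DiffD2 DiffI order_antisym subsetD)
  qed (use that sub in auto)
  have "sum f (D - D') = sum f (D' - D)"
  proof (cases "D - D' = {}")
    case True
    then show ?thesis using cd finD by (metis card_0_eq card.empty finite_Diff)
  next
    case False
    then obtain a where a: "a \<in> D - D'" by blast
    have "D' - D \<noteq> {}" using False cd finD by (metis card_0_eq card.empty finite_Diff)
    then obtain b where b: "b \<in> D' - D" by blast
    have "sum f (D - D') = (\<Sum>x\<in>D - D'. f b)" by (intro sum.cong) (use weq b in auto)
    moreover have "sum f (D' - D) = (\<Sum>x\<in>D' - D. f b)"
      using weq[OF a, symmetric] weq[OF a b] by (intro sum.cong refl) simp
    ultimately show ?thesis using cd by simp
  qed
  moreover have "sum f D = sum f (D - D') + sum f (D \<inter> D')"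
    using finD by (metis sum.Int_Diff add.commute)
  moreover have "sum f D' = sum f (D' - D) + sum f (D \<inter> D')"
    using finD by (metis sum.Int_Diff Int_commute add.commute)
  ultimately show ?thesis by simp
qed

lemma heaviest_exists:
  assumes "finite A"
  shows "\<exists>D. heaviest w t A D"
proof (induction t)
  case 0
  then show ?case by (intro exI[of _ "{}"]) (simp add: heaviest_def)
next
  case (Suc t)
  then obtain D where D: "heaviest w t A D" by blast
  have sub: "D \<subseteq> A" and card: "card D = min t (card A)" using D by (auto simp: heaviest_def)
  have finD: "finite D" using sub assms by (rule finite_subset)
  show ?case
  proof (cases "A - D = {}")
    case True
    then have "D = A" using sub by blast
    then have "heaviest w (Suc t) A D" using card by (auto simp: heaviest_def)
    then show ?thesis ..
  next
    case False
    define m where "m = Max (w ` (A - D))"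
    have "m \<in> w ` (A - D)" unfolding m_def using False assms by (intro Max_in) auto
    then obtain a where a: "a \<in> A - D" "w a = m" by auto
    have am: "w y \<le> w a" if "y \<in> A - D" for y
      using a that assms by (auto simp: m_def)
    have "card D < card A" using a sub assms by (intro psubset_card_mono) auto
    then have "card (insert a D) = min (Suc t) (card A)"
      using card a finD by auto
    then have "heaviest w (Suc t) A (insert a D)"
      using D a am sub by (auto simp: heaviest_def)
    then show ?thesis ..
  qed
qed

lemma nonincreasing_order_exists:
  assumes "finite V"
  shows "\<exists>\<phi>. nonincreasing_order V h \<phi>"
proof -
  obtain xs0 where xs0: "set xs0 = V" "distinct xs0"
    using finite_distinct_list[OF assms] by blast
  define xs where "xs = sort_key (\<lambda>v. - h v) xs0"
  have xs: "set xs = V" "distinct xs" "sorted (map (\<lambda>v. - h v) xs)"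
    using xs0 by (auto simp: xs_def)
  have len: "length xs = card V" using xs distinct_card by fastforce
  have b: "bij_betw (\<lambda>i. i - 1) {1..card V} {..<card V}"
    by (rule bij_betw_byWitness[where f' = Suc]) auto
  have "bij_betw ((!) xs) {..<card V} V"
    using bij_betw_nth[OF xs(2)] xs len by simp
  from bij_betw_trans[OF b this] have 1: "bij_betw ((!) xs \<circ> (\<lambda>i. i - 1)) {1..card V} V" .
  have 2: "h (xs ! (j - 1)) \<le> h (xs ! (i - 1))"
    if "i \<in> {1..card V}" "j \<in> {1..card V}" "i \<le> j" for i j
    using sorted_nth_mono[OF xs(3), of "i - 1" "j - 1"] that len by auto
  show ?thesis
    using 1 2 by (intro exI[of _ "(!) xs \<circ> (\<lambda>i. i - 1)"]) (auto simp: nonincreasing_order_def)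
qed

lemma nonincreasing_order_heaviest:
  assumes "nonincreasing_order V h \<phi>" "k \<le> card V"
  shows "heaviest h k V (\<phi> ` {1..k})" and "(\<Sum>j=1..k. h (\<phi> j)) = sum h (\<phi> ` {1..k})"
proof -
  have bij: "bij_betw \<phi> {1..card V} V"
    and mono: "\<And>i j. \<lbrakk>i \<in> {1..card V}; j \<in> {1..card V}; i \<le> j\<rbrakk> \<Longrightarrow> h (\<phi> j) \<le> h (\<phi> i)"
    using assms by (auto simp: nonincreasing_order_def)
  have img: "\<phi> ` {1..card V} = V" using bij by (simp add: bij_betw_def)
  have inj: "inj_on \<phi> {1..k}"
    using bij assms(2) by (auto simp: bij_betw_def intro: inj_on_subset)
  show "(\<Sum>j=1..k. h (\<phi> j)) = sum h (\<phi> ` {1..k})"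
    using inj by (simp add: sum.reindex)
  have sub: "\<phi> ` {1..k} \<subseteq> V" using img assms(2) by auto
  have "h y \<le> h x" if x: "x \<in> \<phi> ` {1..k}" and y: "y \<in> V - \<phi> ` {1..k}" for x y
  proof -
    obtain i where i: "x = \<phi> i" "i \<in> {1..k}" using x by blast
    have "y \<in> \<phi> ` {1..card V}" using y img by blast
    then obtain j where j: "y = \<phi> j" "j \<in> {1..card V}" by blast
    have "j \<notin> {1..k}" using y j by blast
    then show ?thesis using mono[of i j] i j assms(2) by auto
  qed
  then show "heaviest h k V (\<phi> ` {1..k})"
    using sub inj assms(2) by (auto simp: heaviest_def card_image)
qed

lemma is_UB3_ex1:
  assumes "ewmcp_instance V E c" "k \<le> card V"
  shows "\<exists>!x. is_UB3 V E c k x"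
proof -
  have finV: "finite V" and "finite E"
    using assms(1) finite_imp_finite_nsets[of V 2]
    by (auto simp: ewmcp_instance_def intro: finite_subset)
  then have finI: "finite (incident_edges E u)" for u
    by (simp add: incident_edges_def)
  have "\<exists>D. \<forall>u\<in>V. heaviest c (k - 1) (incident_edges E u) (D u)"
    by (rule bchoice) (use heaviest_exists[OF finI] in blast)
  then have ex: "\<exists>x. is_UB3 V E c k x"
    using nonincreasing_order_exists[OF finV] unfolding is_UB3_def by blast
  moreover have "x = x'" if "is_UB3 V E c k x" "is_UB3 V E c k x'" for x x'
  proof -
    obtain D \<phi> where D: "\<forall>u\<in>V. heaviest c (k - 1) (incident_edges E u) (D u)"
      and \<phi>: "nonincreasing_order V (eta c D) \<phi>" and x: "x = (\<Sum>j=1..k. eta c D (\<phi> j))"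
      using \<open>is_UB3 V E c k x\<close> unfolding is_UB3_def by blast
    obtain D' \<phi>' where D': "\<forall>u\<in>V. heaviest c (k - 1) (incident_edges E u) (D' u)"
      and \<phi>': "nonincreasing_order V (eta c D') \<phi>'" and x': "x' = (\<Sum>j=1..k. eta c D' (\<phi>' j))"
      using \<open>is_UB3 V E c k x'\<close> unfolding is_UB3_def by blast
    have eta: "eta c D' u = eta c D u" if "u \<in> V" for u
    proof -
      have "(\<Sum>e\<in>D' u. real (c e)) = (\<Sum>e\<in>D u. real (c e))"
        by (rule heaviest_sum_unique[OF finI]) (use D D' that in auto)
      then show ?thesis by (simp add: eta_def)
    qed
    have h: "heaviest (eta c D) k V (\<phi> ` {1..k})" "x = sum (eta c D) (\<phi> ` {1..k})"
      using nonincreasing_order_heaviest[OF \<phi> assms(2)] x by auto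
    have h': "heaviest (eta c D') k V (\<phi>' ` {1..k})" "x' = sum (eta c D') (\<phi>' ` {1..k})"
      using nonincreasing_order_heaviest[OF \<phi>' assms(2)] x' by auto
    have "\<phi>' ` {1..k} \<subseteq> V" using h' by (simp add: heaviest_def)
    then have "x' = sum (eta c D) (\<phi>' ` {1..k})"
      unfolding h'(2) by (intro sum.cong) (use eta in auto)
    moreover have "heaviest (eta c D) k V (\<phi>' ` {1..k})"
      using h'(1) eta unfolding heaviest_def by (metis DiffD1 subsetD)
    ultimately show ?thesis
      using heaviest_sum_unique[OF finV h(1), of "\<phi>' ` {1..k}" "eta c D"] h(2) by simp
  qed
  ultimately show ?thesis by blast
qed

lemma UB3_eq:
  assumes "ewmcp_instance V E c" "k \<le> card V"
    and "\<forall>u\<in>V. heaviest c (k - 1) (incident_edges E u) (D u)"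
    and "nonincreasing_order V (eta c D) \<phi>"
  shows "UB3 V E c k = (\<Sum>j=1..k. eta c D (\<phi> j))"
  unfolding UB3_def
  by (rule the1_equality[OF is_UB3_ex1[OF assms(1,2)]]) (use assms(3,4) in \<open>auto simp: is_UB3_def\<close>)


section \<open>Two disjoint cliques joined by a heavy perfect matching\<close>

definition G1_verts :: "nat \<Rightarrow> nat set" where
  "G1_verts n = {1..2 * n}"

definition G1_matching :: "nat \<Rightarrow> nat set set" where
  "G1_matching n = {{u, n + u} |u. u \<in> {1..n}}"

definition G1_edges :: "nat \<Rightarrow> nat set set" where
  "G1_edges n = [{1..n}]\<^bsup>2\<^esup> \<union> [{n + 1..2 * n}]\<^bsup>2\<^esup> \<union> G1_matching n"

text \<open>
  For \<open>n \<ge> 2\<close> both the division and the subtraction in the matching weight are exact.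
\<close>

definition G1_weight :: "nat \<Rightarrow> nat set \<Rightarrow> nat" where
  "G1_weight n e = (if e \<in> G1_matching n then n * (n - 1) div 2 - 1 else 1)"

lemma G1_ewmcp_instance: "ewmcp_instance (G1_verts n) (G1_edges n) (G1_weight n)"
  unfolding ewmcp_instance_def
proof
  show "finite (G1_verts n)" by (simp add: G1_verts_def)
  have "[{1..n}]\<^bsup>2\<^esup> \<subseteq> [G1_verts n]\<^bsup>2\<^esup>" "[{n + 1..2 * n}]\<^bsup>2\<^esup> \<subseteq> [G1_verts n]\<^bsup>2\<^esup>"
    by (rule nsets_mono; force simp: G1_verts_def)+
  moreover have "G1_matching n \<subseteq> [G1_verts n]\<^bsup>2\<^esup>"
    by (auto simp: G1_matching_def G1_verts_def)
  ultimately show "G1_edges n \<subseteq> [G1_verts n]\<^bsup>2\<^esup>" by (simp add: G1_edges_def)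
qed

end

theory Submission
  imports Defs
begin

text \<open>
  Every edge between the two halves belongs to the matching, so a clique meeting both halves is a
  single matching edge, whose weight is one less than the \<open>n choose 2\<close> collected by a whole half
  (\<open>G1_clique_cases\<close>).  Hence the maximum clique weight is exactly \<open>n choose 2\<close>, the
  matching edges being useless: a clique that uses one of them uses no other edge.

  The bound ignores this obstruction.  Each of the \<open>2 n\<close> vertices is incident to a matching
  edge, so each \<open>\<eta>\<close> is at least half the weight of that edge (\<open>weight_le_sum_heaviest\<close>), and the
  bound, a sum of \<open>n\<close> such values, is at least \<open>n / 2\<close> times the weight of a matching edge.  That
  weight being almost \<open>n choose 2\<close>, the ratio grows at least linearly in \<open>n\<close>.
\<close>

section \<open>Cliques of the instances\<close>

lemma induced_edges_clique:
  assumes "clique C E" "E \<subseteq> [V]\<^bsup>2\<^esup>"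
  shows "induced_edges E C = [C]\<^bsup>2\<^esup>"
proof
  show "induced_edges E C \<subseteq> [C]\<^bsup>2\<^esup>"
    using assms(2) by (auto simp: induced_edges_def nsets_def)
  show "[C]\<^bsup>2\<^esup> \<subseteq> induced_edges E C"
    using assms(1) by (auto simp: induced_edges_def nsets_2_eq clique_def)
qed

text \<open>
  Every vertex has exactly one neighbour in the other half.  Hence two clique members from different
  halves determine each other, and a third member would have to coincide with one of them.
\<close>

lemma G1_clique_cases:
  assumes "C \<in> cliques (G1_verts n) (G1_edges n)"
  obtains (lower) "C \<subseteq> {1..n}" | (upper) "C \<subseteq> {n + 1..2 * n}"
    | (matched) u where "u \<in> {1..n}" "C = {u, n + u}"
proof -
  have C: "C \<subseteq> {1..n} \<union> {n + 1..2 * n}"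
    using assms by (force simp: cliques_def G1_verts_def)
  have cross: "v = n + u" if "u \<in> C" "u \<in> {1..n}" "v \<in> C" "v \<in> {n + 1..2 * n}" for u v
  proof -
    have "{u, v} \<in> G1_edges n"
      using assms that by (auto simp: cliques_def clique_def)
    then show ?thesis
      using that by (auto simp: G1_edges_def G1_matching_def nsets_def doubleton_eq_iff)
  qed
  show thesis
  proof (cases "C \<subseteq> {1..n} \<or> C \<subseteq> {n + 1..2 * n}")
    case True
    then show ?thesis using lower upper by blast
  next
    case False
    then obtain u v where u: "u \<in> C" "u \<in> {1..n}" and v: "v \<in> C" "v \<in> {n + 1..2 * n}"
      using C by blast
    have "C \<subseteq> {u, n + u}"
    proof
      fix w assume w: "w \<in> C"
      then consider "w \<in> {1..n}" | "w \<in> {n + 1..2 * n}" using C by blast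
      then show "w \<in> {u, n + u}"
        using cross[OF u v] cross[OF u w] cross[OF w _ v] by cases auto
    qed
    moreover have "{u, n + u} \<subseteq> C" using u v cross[OF u v] by auto
    ultimately have "C = {u, n + u}" by blast
    with u(2) show ?thesis by (rule matched)
  qed
qed

lemma G1_half_clique: "{1..n} \<in> cliques (G1_verts n) (G1_edges n)"
  by (auto simp: cliques_def clique_def G1_verts_def G1_edges_def)

lemma finite_G1_cliques: "finite (cliques (G1_verts n) (G1_edges n))"
  by (rule finite_subset[of _ "Pow (G1_verts n)"]) (auto simp: cliques_def G1_verts_def)

lemma card_G1_clique_le:
  assumes "n \<ge> 2" "C \<in> cliques (G1_verts n) (G1_edges n)"
  shows "card C \<le> n"
  using assms(2)
proof (cases rule: G1_clique_cases)
  case lower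
  then show ?thesis using card_mono[of "{1..n}" C] by simp
next
  case upper
  then show ?thesis using card_mono[of "{n + 1..2 * n}" C] by simp
next
  case matched
  then show ?thesis using assms(1) by simp
qed

lemma clique_number_G1:
  assumes "n \<ge> 2"
  shows "clique_number (G1_verts n) (G1_edges n) = n"
  unfolding clique_number_def
proof (rule Max_eqI)
  show "n \<in> card ` cliques (G1_verts n) (G1_edges n)"
    using G1_half_clique by (rule rev_image_eqI) simp
qed (use finite_G1_cliques card_G1_clique_le[OF assms] in auto)


section \<open>The maximum clique weight\<close>

lemma clique_weight_G1_half:
  assumes "C \<in> cliques (G1_verts n) (G1_edges n)" "C \<subseteq> {1..n} \<or> C \<subseteq> {n + 1..2 * n}"
  shows "clique_weight (G1_edges n) (G1_weight n) C = card C choose 2"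
proof -
  have "finite C"
    using assms(2) by (auto intro: finite_subset)
  have "induced_edges (G1_edges n) C = [C]\<^bsup>2\<^esup>"
    using assms(1) G1_ewmcp_instance[of n]
    by (auto simp: cliques_def ewmcp_instance_def dest: induced_edges_clique)
  moreover have "G1_weight n e = 1" if "e \<in> [C]\<^bsup>2\<^esup>" for e
  proof -
    have "e \<subseteq> C" using that by (simp add: nsets_def)
    have "e \<notin> G1_matching n"
    proof
      assume "e \<in> G1_matching n"
      then obtain u where "u \<in> {1..n}" "e = {u, n + u}"
        unfolding G1_matching_def by blast
      then have "{u, n + u} \<subseteq> {1..n} \<or> {u, n + u} \<subseteq> {n + 1..2 * n}"
        using assms(2) \<open>e \<subseteq> C\<close> by blast
      then show False using \<open>u \<in> {1..n}\<close> by simp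
    qed
    then show ?thesis by (simp add: G1_weight_def)
  qed
  ultimately show ?thesis
    using \<open>finite C\<close> by (simp add: clique_weight_def)
qed

lemma clique_weight_G1_le:
  assumes "n \<ge> 2" "C \<in> cliques (G1_verts n) (G1_edges n)"
  shows "clique_weight (G1_edges n) (G1_weight n) C \<le> n choose 2"
  using assms(2)
proof (cases rule: G1_clique_cases)
  case lower
  then show ?thesis
    using clique_weight_G1_half[OF assms(2)] card_G1_clique_le[OF assms] by (simp add: binomial_right_mono)
next
  case upper
  then show ?thesis
    using clique_weight_G1_half[OF assms(2)] card_G1_clique_le[OF assms] by (simp add: binomial_right_mono)
next
  case (matched u)
  have "induced_edges (G1_edges n) C = [C]\<^bsup>2\<^esup>"
    using assms(2) G1_ewmcp_instance[of n]
    by (auto simp: cliques_def ewmcp_instance_def dest: induced_edges_clique)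
  moreover have "[C]\<^bsup>2\<^esup> = {{u, n + u}}"
    using matched by (auto simp: nsets_2_eq)
  moreover have "{u, n + u} \<in> G1_matching n"
    using matched by (auto simp: G1_matching_def)
  ultimately show ?thesis
    by (simp add: clique_weight_def G1_weight_def choose_two)
qed

lemma omega_G1:
  assumes "n \<ge> 2"
  shows "omega (G1_verts n) (G1_edges n) (G1_weight n) = n choose 2"
  unfolding omega_def
proof (rule Max_eqI)
  show "n choose 2 \<in> clique_weight (G1_edges n) (G1_weight n) ` cliques (G1_verts n) (G1_edges n)"
    using G1_half_clique
    by (rule rev_image_eqI) (subst clique_weight_G1_half[OF G1_half_clique]; simp)
qed (use finite_G1_cliques clique_weight_G1_le[OF assms] in auto)


section \<open>The upper bound on the instances\<close>

text \<open>
  A selection of heaviest elements either contains a given element or consists of elements at least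
  as heavy; being nonempty, it weighs in total
  no less than that element in both cases.
\<close>

lemma weight_le_sum_heaviest:
  fixes w :: "'b \<Rightarrow> nat"
  assumes "finite A" "heaviest w t A D" "t \<ge> 1" "a \<in> A"
  shows "w a \<le> sum w D"
proof -
  have "finite D" using assms(1,2) by (auto simp: heaviest_def intro: finite_subset)
  have "card A > 0" using assms(1,4) card_gt_0_iff by blast
  then have "D \<noteq> {}" using assms(2,3) by (auto simp: heaviest_def)
  then obtain d where d: "d \<in> D" "w a \<le> w d"
    using assms(2,4) unfolding heaviest_def by (metis DiffI ex_in_conv order_refl)
  note d(2)
  also have "w d \<le> sum w D" using \<open>finite D\<close> d(1) by (simp add: member_le_sum)
  finally show ?thesis .
qed

text \<open>
  As \<open>k \<ge> 2\<close>, at least one edge is selected at every vertex, so a single edge of weight \<open>m\<close> there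
  already forces \<open>m / 2\<close> into every summand, whatever the order of the vertices.
\<close>

lemma UB3_ge:
  assumes inst: "ewmcp_instance V E c" and k: "2 \<le> k" "k \<le> card V"
    and heavy: "\<And>u. u \<in> V \<Longrightarrow> \<exists>e\<in>incident_edges E u. c e = m"
  shows "real k * (real m / 2) \<le> UB3 V E c k"
proof -
  obtain x where "is_UB3 V E c k x"
    using is_UB3_ex1[OF inst k(2)] by blast
  then obtain D \<phi> where D: "\<forall>u\<in>V. heaviest c (k - 1) (incident_edges E u) (D u)"
    and \<phi>: "nonincreasing_order V (eta c D) \<phi>"
    unfolding is_UB3_def by blast
  have "finite E"
    using inst finite_imp_finite_nsets[of V 2]
    by (auto simp: ewmcp_instance_def intro: finite_subset)
  then have fin: "finite (incident_edges E u)" for u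
    by (simp add: incident_edges_def)
  have "real m / 2 \<le> eta c D u" if "u \<in> V" for u
  proof -
    obtain e where e: "e \<in> incident_edges E u" "c e = m"
      using heavy[OF \<open>u \<in> V\<close>] by (rule bexE)
    have "heaviest c (k - 1) (incident_edges E u) (D u)"
      using D \<open>u \<in> V\<close> by (rule bspec)
    moreover have "1 \<le> k - 1" using k(1) by linarith
    ultimately have "m \<le> sum c (D u)"
      using weight_le_sum_heaviest[OF fin _ _ e(1)] e(2) by metis
    then have "real m \<le> real (sum c (D u))" by (rule of_nat_mono)
    then show ?thesis by (simp add: eta_def)
  qed
  moreover have "\<phi> j \<in> V" if "j \<in> {1..k}" for j
    using \<phi> k(2) that by (auto simp: nonincreasing_order_def bij_betw_def)
  ultimately have "of_nat (card {1..k}) * (real m / 2) \<le> (\<Sum>j=1..k. eta c D (\<phi> j))"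
    by (intro sum_bounded_below) blast
  then show ?thesis
    using UB3_eq[OF inst k(2) D \<phi>] by simp
qed

lemma UB3_G1_ge:
  assumes "n \<ge> 2"
  shows "real n * (real ((n choose 2) - 1) / 2) \<le> UB3 (G1_verts n) (G1_edges n) (G1_weight n) n"
proof (rule UB3_ge[OF G1_ewmcp_instance assms])
  show "n \<le> card (G1_verts n)" by (simp add: G1_verts_def)
next
  fix v assume v: "v \<in> G1_verts n"
  define u where "u = (if v \<le> n then v else v - n)"
  have u: "u \<in> {1..n}" "v \<in> {u, n + u}" using v by (auto simp: u_def G1_verts_def)
  then have "{u, n + u} \<in> G1_matching n" by (auto simp: G1_matching_def)
  with u(2) show "\<exists>e\<in>incident_edges (G1_edges n) v. G1_weight n e = (n choose 2) - 1"
    by (intro bexI[of _ "{u, n + u}"])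
      (auto simp: incident_edges_def G1_edges_def G1_weight_def choose_two)
qed


section \<open>Divergence of the ratio\<close>

theorem proposition10:
  shows "(\<forall>n\<ge>2. clique_number (G1_verts n) (G1_edges n) = n) \<and>
    filterlim
      (\<lambda>n. UB3 (G1_verts n) (G1_edges n) (G1_weight n) n
            / real (omega (G1_verts n) (G1_edges n) (G1_weight n)))
      at_top sequentially"
proof
  show "\<forall>n\<ge>2. clique_number (G1_verts n) (G1_edges n) = n"
    using clique_number_G1 by blast
next
  have "real n / 4 \<le> UB3 (G1_verts n) (G1_edges n) (G1_weight n) n
      / real (omega (G1_verts n) (G1_edges n) (G1_weight n))" if "n \<ge> 3" for n
  proof -
    (* From n = 3 on, the matching weight is at least half of the maximum clique weight. *)
    have "3 choose 2 \<le> n choose 2" using that by (rule binomial_right_mono)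
    moreover have "(3::nat) choose 2 = 3" by (simp add: choose_two)
    ultimately have c: "n choose 2 \<ge> 2" by simp
    then have "real (n choose 2) / 2 \<le> real ((n choose 2) - 1)" by linarith
    then have "real n * (real (n choose 2) / 2 / 2) \<le> real n * (real ((n choose 2) - 1) / 2)"
      by (intro mult_left_mono divide_right_mono) auto
    also have "\<dots> \<le> UB3 (G1_verts n) (G1_edges n) (G1_weight n) n"
      using that by (intro UB3_G1_ge) simp
    finally have "real n / 4 * real (n choose 2) \<le> UB3 (G1_verts n) (G1_edges n) (G1_weight n) n"
      by simp
    moreover have "0 < real (n choose 2)"
      using less_le_trans[OF zero_less_numeral c] by (rule of_nat_less_iff[THEN iffD2, of 0, unfolded of_nat_0])
    ultimately have "real n / 4 \<le> UB3 (G1_verts n) (G1_edges n) (G1_weight n) n / real (n choose 2)"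
      by (simp only: pos_le_divide_eq)
    then show ?thesis
      using that by (simp add: omega_G1)
  qed
  then have "\<forall>\<^sub>F n in sequentially. real n / 4 \<le> UB3 (G1_verts n) (G1_edges n) (G1_weight n) n
      / real (omega (G1_verts n) (G1_edges n) (G1_weight n))"
    by (rule eventually_sequentiallyI)
  moreover have "filterlim (\<lambda>n. real n / 4) at_top sequentially"
    using filterlim_tendsto_pos_mult_at_top[OF tendsto_const[of "1/4::real"] _ filterlim_real_sequentially]
    by simp
  ultimately show "filterlim
      (\<lambda>n. UB3 (G1_verts n) (G1_edges n) (G1_weight n) n
            / real (omega (G1_verts n) (G1_edges n) (G1_weight n)))
      at_top sequentially"
    by (rule filterlim_at_top_mono[rotated])
qed

end
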